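(* Let $\mathcal{G}=(\mathcal{V},\mathcal{E})$ be a (nondirected simple finite) connected graph. Suppose that $|\mathcal{V}|=2^m$, $m\ge1$, and that $\mathcal{G}$ has a spanning subgraph isomorphic to the $m$-cube graph $\mathcal{Q}_m$. Then there exist weight matrices $W_1,W_2,\dots,W_m$ for $\mathcal{G}$ such that distributed averaging is performed for $\mathcal{G}$ in $m$ steps (for any initial value vector $q_0$).
   Context: The $m$-cube graph $\mathcal{Q}_m$ has vertex set $\{0,1\}^m$, two vertices being adjacent iff they differ in exactly one coordinate. Vectors are row vectors and $'$ denotes transpose. Let $\mathcal{G}=(\mathcal{V},\mathcal{E})$ be a connected graph with $r=|\mathcal{V}|\ge2$ vertices. For $i\in\mathcal{V}$ let $\mathcal{N}_i=\{j\in\mathcal{V}:\{i,j\}\in\mathcal{E}\}$. A *weight matrix* for $\mathcal{G}$ is a real matrix $W$ with rows and columns indexed by $\mathcal{V}$ such that $W_{ij}=0$ whenever $j\notin\{i\}\cup\mathcal{N}_i$ (entries with $j\in\{i\}\cup\mathcal{N}_i$ are arbitrary reals, possibly zero; $W$ need not be symmetric). Given an initial value vector $q_0=(q_{0i})_{i\in\mathcal{V}}\in\mathbb{R}^{\mathcal{V}}$ and weight matrices $W_n$, $n\ge1$, the value vectors are given by $q_n'=W_nq_{n-1}'$, so $q_n'=W_nW_{n-1}\cdots W_1q_0'$. Distributed averaging is performed by $\mathcal{G}$ if $\lim_{n\to\infty}W_n\cdots W_1=e'\left(\frac1r,\dots,\frac1r\right)$, $e=(1,\dots,1)$. It is performed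 in $m$ steps by $W_1,\dots,W_m$ if $$W_mW_{m-1}\cdots W_1=e'\left(\tfrac1r,\tfrac1r,\dots,\tfrac1r\right),$$ i.e. every entry of the product equals $1/r$; equivalently, for every $q_0$, each component of $q_m$ equals $\frac1r\sum_{i\in\mathcal{V}}q_{0i}$. (One may then take $W_{m+1}=W_{m+2}=\cdots=I_r$.) *)

theory Defs
  imports "HOL-Analysis.Analysis" "Graph_Theory.Digraph_Isomorphism"
begin

text \<open>
  A finite simple graph is a \<^locale>\<open>pair_graph\<close>: a finite loop-free symmetric digraph, the edge
  \<open>{i, j}\<close> being the pair of arcs \<open>(i, j)\<close> and \<open>(j, i)\<close>. Matrices and vectors indexed by the
  vertex set are those of HOL-Analysis over the index type \<open>'v\<close>, so the graphs considered below
  have \<open>pverts G = UNIV\<close> (with \<open>'v\<close> an arbitrary finite type). The row vectors \<open>q\<close>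
  of the paper enter only through their transposes, which are the arguments of \<open>*v\<close>.
\<close>

definition cube_graph :: "nat \<Rightarrow> bool list pair_pre_digraph" where
  "cube_graph m =
    \<lparr> pverts = {x. length x = m},
      parcs = {(x, y). length x = m \<and> length y = m \<and> (\<exists>!k. k < m \<and> x ! k \<noteq> y ! k)} \<rparr>"

definition nbhd :: "'v pair_pre_digraph \<Rightarrow> 'v \<Rightarrow> 'v set" where
  "nbhd G i = {j \<in> pverts G. (i, j) \<in> parcs G}"

definition weight_matrix :: "'v::finite pair_pre_digraph \<Rightarrow> real^'v^'v \<Rightarrow> bool" where
  "weight_matrix G W \<longleftrightarrow> (\<forall>i j. j \<notin> {i} \<union> nbhd G i \<longrightarrow> W $ i $ j = 0)"

text \<open>\<open>W 0\<close> is never used: the sequence of weight matrices is \<open>W 1, W 2, \<dots>\<close>, and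
  \<open>weight_prod W n\<close> is \<open>W n ** \<dots> ** W 1\<close>.\<close>

primrec weight_prod :: "(nat \<Rightarrow> real^'v^'v) \<Rightarrow> nat \<Rightarrow> real^'v::finite^'v" where
  "weight_prod W 0 = mat 1"
| "weight_prod W (Suc n) = W (Suc n) ** weight_prod W n"

primrec value_vec :: "(nat \<Rightarrow> real^'v^'v) \<Rightarrow> real^'v \<Rightarrow> nat \<Rightarrow> real^'v::finite" where
  "value_vec W q 0 = q"
| "value_vec W q (Suc n) = W (Suc n) *v value_vec W q n"

definition averaging_in_steps ::
  "'v::finite pair_pre_digraph \<Rightarrow> (nat \<Rightarrow> real^'v^'v) \<Rightarrow> nat \<Rightarrow> bool" where
  "averaging_in_steps G W m \<longleftrightarrow> weight_prod W m = (\<chi> i j. 1 / real (card (pverts G)))"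

lemma pair_graph_cube_graph: "pair_graph (cube_graph m)"
proof -
  have fin: "finite {x :: bool list. length x = m}"
    using finite_lists_length_eq[of "UNIV :: bool set" m] by simp
  have "parcs (cube_graph m) \<subseteq> {x. length x = m} \<times> {x. length x = m}"
    by (auto simp: cube_graph_def)
  then have "finite (parcs (cube_graph m))"
    by (rule finite_subset) (simp add: fin)
  moreover have "symmetric (with_proj (cube_graph m))"
    unfolding Digraph.symmetric_def with_proj_simps
  proof (rule symI)
    fix x y assume "(x, y) \<in> parcs (cube_graph m)"
    then have "length x = m" "length y = m" "\<exists>!k. k < m \<and> x ! k \<noteq> y ! k"
      by (simp_all add: cube_graph_def)
    moreover from this(3) have "\<exists>!k. k < m \<and> y ! k \<noteq> x ! k"
      by metis
    ultimately show "(y, x) \<in> parcs (cube_graph m)"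
      by (simp add: cube_graph_def)
  qed
  moreover have "fst e \<noteq> snd e" if "e \<in> parcs (cube_graph m)" for e
  proof
    assume "fst e = snd e"
    with that have "\<exists>!k. k < m \<and> fst e ! k \<noteq> fst e ! k"
      by (simp add: cube_graph_def case_prod_beta)
    then show False
      by (elim ex1E) simp
  qed
  moreover have "fst e \<in> pverts (cube_graph m)" "snd e \<in> pverts (cube_graph m)"
    if "e \<in> parcs (cube_graph m)" for e
    using that by (simp_all add: cube_graph_def case_prod_beta)
  moreover have "finite (pverts (cube_graph m))"
    using fin by (simp add: cube_graph_def)
  ultimately show ?thesis
    by unfold_locales
qed

lemma card_pverts_cube_graph: "card (pverts (cube_graph m)) = 2 ^ m"
  using card_lists_length_eq[of "UNIV :: bool set" m] by (simp add: cube_graph_def)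

end

theory Submission
  imports Defs
begin

text \<open>
  Label the vertices by the \<open>0\<close>--\<open>1\<close> words of length \<open>m\<close>, so that words differing in one
  position are joined in the graph, and let step \<open>k\<close> replace the value at a vertex by the mean
  of the values at the vertex and at its neighbour across coordinate \<open>k\<close>. The coordinates are
  thus averaged out one after another: after \<open>n\<close> steps, each vertex holds the mean of the initial
  values over the \<open>2\<^sup>n\<close> words that agree with its own in all but the first \<open>n\<close> positions
  (lemma \<open>weight_prod_coordinate_averaging\<close>). For \<open>n = m\<close> this is the mean over all
  vertices. The only edges used are those of the cube, so every step is a weight matrix of any graph
  that contains a spanning cube (lemma \<open>weight_matrix_coordinate_averaging\<close>).
\<close>

text \<open>
  The condition lets \<open>j\<close> run over \<open>i\<close> and its neighbour across one coordinate. Steps are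
  counted from \<open>1\<close> and list positions from \<open>0\<close>, so step \<open>k\<close> averages over position
  \<open>k - 1\<close>.
\<close>

definition coordinate_averaging ::
  "nat \<Rightarrow> ('v \<Rightarrow> bool list) \<Rightarrow> nat \<Rightarrow> real^'v::finite^'v" where
  "coordinate_averaging m f k =
    (\<chi> i j. if \<forall>l<m. Suc l \<noteq> k \<longrightarrow> f i ! l = f j ! l then 1 / 2 else 0)"

text \<open>
  In the product of step \<open>n + 1\<close> with the first \<open>n\<close> steps, the \<open>(i, j)\<close> entry is a sum
  over intermediate vertices \<open>p\<close>. A contributing \<open>p\<close> agrees with \<open>i\<close> off position \<open>n\<close>
  and with \<open>j\<close> from position \<open>n\<close> on, which determines it: its word is that of \<open>i\<close> with
  the bit at position \<open>n\<close> taken from \<open>j\<close>. So no two terms ever add up, and each step merely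
  contributes a factor \<open>1 / 2\<close>.
\<close>

lemma weight_prod_coordinate_averaging:
  fixes f :: "'v::finite \<Rightarrow> bool list"
  assumes f: "bij_betw f UNIV {x. length x = m}" and "n \<le> m"
  shows "weight_prod (coordinate_averaging m f) n $ i $ j =
    (if \<forall>l\<in>{n..<m}. f i ! l = f j ! l then 1 / 2 ^ n else 0)"
  using \<open>n \<le> m\<close>
proof (induction n arbitrary: i j)
  case 0
  have len: "length (f v) = m" for v
    using f by (auto simp: bij_betw_def)
  have "(\<forall>l\<in>{0..<m}. f i ! l = f j ! l) \<longleftrightarrow> f i = f j"
    using len by (auto simp: list_eq_iff_nth_eq)
  also have "\<dots> \<longleftrightarrow> i = j"
    using f by (auto simp: bij_betw_def inj_eq)
  finally show ?case
    by (simp add: mat_def)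
next
  case (Suc n)
  have len: "length (f v) = m" for v
    using f by (auto simp: bij_betw_def)
  have "(f i)[n := f j ! n] \<in> range f"
    using f len by (auto simp: bij_betw_def)
  then obtain p0 where p0: "f p0 = (f i)[n := f j ! n]"
    by (metis imageE)
  let ?near = "\<lambda>p. \<forall>l<m. Suc l \<noteq> Suc n \<longrightarrow> f i ! l = f p ! l"
  let ?rest = "\<lambda>p. \<forall>l\<in>{n..<m}. f p ! l = f j ! l"
  let ?goal = "\<forall>l\<in>{Suc n..<m}. f i ! l = f j ! l"
  have eq: "?near p \<and> ?rest p \<longleftrightarrow> p = p0 \<and> ?goal" for p
  proof
    assume p: "?near p \<and> ?rest p"
    have "f p = f p0"
      unfolding p0 using p len Suc.prems by (auto simp: list_eq_iff_nth_eq nth_list_update)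
    then have "p = p0"
      using f by (auto simp: bij_betw_def inj_eq)
    with p show "p = p0 \<and> ?goal" by auto
  next
    assume "p = p0 \<and> ?goal"
    then show "?near p \<and> ?rest p"
      using p0 len Suc.prems by (auto simp: nth_list_update)
  qed
  have "weight_prod (coordinate_averaging m f) (Suc n) $ i $ j =
      (\<Sum>p\<in>UNIV. (if ?near p then 1 / 2 else 0) * (if ?rest p then 1 / 2 ^ n else 0))"
    using Suc.prems by (simp add: matrix_matrix_mult_def coordinate_averaging_def Suc.IH)
  also have "\<dots> = (\<Sum>p\<in>UNIV. if ?near p \<and> ?rest p then 1 / 2 ^ Suc n else 0)"
    by (intro sum.cong) auto
  also have "\<dots> = (\<Sum>p\<in>UNIV. if p = p0 then if ?goal then 1 / 2 ^ Suc n else 0 else 0)"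
    unfolding eq by (intro sum.cong) auto
  also have "\<dots> = (if ?goal then 1 / 2 ^ Suc n else 0)"
    by simp
  finally show ?case .
qed

lemma weight_matrix_coordinate_averaging:
  fixes f :: "'v::finite \<Rightarrow> bool list"
  assumes f: "bij_betw f UNIV {x. length x = m}"
    and arcs: "\<And>i j. (f i, f j) \<in> parcs (cube_graph m) \<Longrightarrow> j \<in> nbhd G i"
  shows "weight_matrix G (coordinate_averaging m f k)"
  unfolding weight_matrix_def
proof (intro allI impI)
  fix i j assume j: "j \<notin> {i} \<union> nbhd G i"
  have len: "length (f v) = m" for v
    using f by (auto simp: bij_betw_def)
  have "f i \<noteq> f j"
    using f j by (auto simp: bij_betw_def inj_eq)
  then obtain l where l: "l < m" "f i ! l \<noteq> f j ! l"
    using len by (auto simp: list_eq_iff_nth_eq)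
  have "(f i, f j) \<notin> parcs (cube_graph m)"
    using j arcs by auto
  \<comment> \<open>The words differ, but not in exactly one position, so they differ in some position that the
    step leaves alone.\<close>
  then have "\<not> (\<exists>!l. l < m \<and> f i ! l \<noteq> f j ! l)"
    using len by (simp add: cube_graph_def)
  then obtain l' where "l' < m" "f i ! l' \<noteq> f j ! l'" "l' \<noteq> l"
    using l by blast
  with l have "\<exists>l<m. Suc l \<noteq> k \<and> f i ! l \<noteq> f j ! l"
    by (metis nat.inject)
  then show "coordinate_averaging m f k $ i $ j = 0"
    by (auto simp: coordinate_averaging_def)
qed

text \<open>
  An isomorphism of digraphs acts on arcs by a map of its own. Compatibility with tails and heads,
  which in both graphs are the projections of a pair, forces this map to be the one induced on pairs
  of vertices; injectivity on vertices then carries cube arcs back to arcs.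
\<close>

lemma digraph_iso_with_proj_obtain:
  assumes "digraph_iso (with_proj H) (with_proj K)"
  obtains f where "bij_betw f (pverts H) (pverts K)"
    and "\<And>i j. i \<in> pverts H \<Longrightarrow> j \<in> pverts H \<Longrightarrow> (f i, f j) \<in> parcs K \<Longrightarrow> (i, j) \<in> parcs H"
proof -
  obtain h where h: "pre_digraph.digraph_isomorphism (with_proj H) h"
    and K: "with_proj K = app_iso h (with_proj H)"
    using assms by (auto simp: digraph_iso_def)
  have verts: "pverts K = iso_verts h ` pverts H"
    and arcs: "parcs K = iso_arcs h ` parcs H"
    and proj: "iso_tail h = fst" "iso_head h = snd"
    using K by (auto simp: with_proj_def app_iso_def)
  have wf: "wf_digraph (with_proj H)" and inj: "inj_on (iso_verts h) (pverts H)"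
    and ends: "\<And>a. a \<in> parcs H \<Longrightarrow>
      iso_arcs h a = (iso_verts h (fst a), iso_verts h (snd a))"
    using h unfolding pre_digraph.digraph_isomorphism_def proj by (auto simp: prod_eq_iff)
  show ?thesis
  proof
    show "bij_betw (iso_verts h) (pverts H) (pverts K)"
      using inj verts by (simp add: bij_betw_def)
  next
    fix i j
    assume i: "i \<in> pverts H" and j: "j \<in> pverts H"
      and "(iso_verts h i, iso_verts h j) \<in> parcs K"
    then obtain a where a: "a \<in> parcs H"
      "iso_verts h i = iso_verts h (fst a)" "iso_verts h j = iso_verts h (snd a)"
      using arcs ends by auto
    have "fst a \<in> pverts H" "snd a \<in> pverts H"
      using wf a(1) by (auto dest: wf_digraph.tail_in_verts wf_digraph.head_in_verts)
    then have "i = fst a" "j = snd a"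
      using a i j inj by (auto dest: inj_onD)
    then show "(i, j) \<in> parcs H"
      using a(1) by simp
  qed
qed

lemma value_vec_eq_weight_prod: "value_vec W q n = weight_prod W n *v q"
  by (induction n) (simp_all add: matrix_vector_mul_assoc)

theorem theorem3p3:
  fixes G :: "'v::finite pair_pre_digraph" and m :: nat
  assumes "pair_graph G" and "pverts G = UNIV"
    and "Digraph_Component.connected (with_proj G)"
    and "card (pverts G) = 2 ^ m" and "m \<ge> 1"
    and "\<exists>H :: 'v pair_pre_digraph. pair_graph H \<and> spanning (with_proj H) (with_proj G) \<and>
           digraph_iso (with_proj H) (with_proj (cube_graph m))"
  shows "\<exists>W :: nat \<Rightarrow> real^'v^'v.
           (\<forall>k\<in>{1..m}. weight_matrix G (W k)) \<and>
           averaging_in_steps G W m \<and>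
           (\<forall>q i. value_vec W q m $ i = 1 / real (card (pverts G)) * (\<Sum>j\<in>pverts G. q $ j))"
proof -
  obtain H :: "'v pair_pre_digraph" where span: "spanning (with_proj H) (with_proj G)"
    and iso: "digraph_iso (with_proj H) (with_proj (cube_graph m))"
    using assms(6) by blast
  have H: "pverts H = UNIV" "parcs H \<subseteq> parcs G"
    using span assms(2) by (auto simp: spanning_def subgraph_def)
  obtain f where "bij_betw f (pverts H) (pverts (cube_graph m))"
    and arcs: "\<And>i j. i \<in> pverts H \<Longrightarrow> j \<in> pverts H \<Longrightarrow>
      (f i, f j) \<in> parcs (cube_graph m) \<Longrightarrow> (i, j) \<in> parcs H"
    using digraph_iso_with_proj_obtain[OF iso] by blast
  then have f: "bij_betw f UNIV {x. length x = m}"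
    by (simp add: H cube_graph_def)
  let ?W = "coordinate_averaging m f"
  have "weight_matrix G (?W k)" for k
    using f by (rule weight_matrix_coordinate_averaging)
      (use arcs H assms(2) in \<open>auto simp: nbhd_def\<close>)
  moreover have prod: "weight_prod ?W m = (\<chi> i j. 1 / real (card (pverts G)))"
    using weight_prod_coordinate_averaging[OF f order_refl] assms(4) by (simp add: vec_eq_iff)
  moreover have "value_vec ?W q m $ i = 1 / real (card (pverts G)) * (\<Sum>j\<in>pverts G. q $ j)"
    for q i
    using assms(2)
    by (simp add: value_vec_eq_weight_prod prod matrix_vector_mult_def sum_divide_distrib)
  ultimately show ?thesis
    unfolding averaging_in_steps_def by blast
qed

end
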